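(* Let $(\mathcal{R},\oplus,\leqslant)$ be a lattice ordered monoid with neutral element $0$ whose lattice is conditionally complete, let $D=(V,A)$ be a finite digraph with $o,d\in V$, let $(x_a)_{a\in A}\in\mathcal{R}^A$, and let $c:\mathcal{R}\to\mathbb{R}$ and $\rho:\mathcal{R}\to\{0,1\}$ be isotone. Suppose that every cycle $C$ in $D$ satisfies $x_C\geqslant 0$. Then the label dominance algorithm terminates after a finite number of iterations, and at the end, if $c_{od}^{UB}$ is finite, then $c_{od}^{UB}$ is the cost of a non-dominated optimal solution of the Monoid Resource Constrained Shortest Path Problem; otherwise, the problem admits no feasible solution.
   Context: A lattice ordered monoid $(\mathcal{R},\oplus,\leqslant)$ is a monoid $(\mathcal{R},\oplus)$ (associative, with neutral element $0$, possibly non-commutative) with a partial order $\leqslant$ that is a lattice order and is such that all translations $y\mapsto x\oplus y$ and $y\mapsto y\oplus x$ are isotone (order-preserving). Conditionally complete: every nonempty bounded subset has a meet and a join. Paths are finite sequences of arcs, the head of each being the tail of the next; vertices and arcs may be repeated, and empty paths (one at each vertex, with resource $0$) are allowed. A cycle is a nonempty path whose origin equals its destination. The resource of a path $P=(a_1,\dots,a_k)$ is $x_P=x_{a_1}\oplus\cdots\oplus x_{a_k}$. $P$ is feasible if $\rho(x_P)=0$; its cost is $c(x_P)$. The Monoid Resource Constrained Shortest Path Problem asks for a feasible $o$-$d$ path of minimum cost; an optimal solution is such a path. An $o$-$v$ path $P$ dominates an $o$-$v$ path $\tilde P$ if $x_P\leqslant x_{\tilde P}$. An optimal solution $P$ is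 called non-dominated if there is no $o$-$d$ path $Q$ with $x_Q<x_P$. Label dominance algorithm: maintain a list $L$ of paths with origin $o$, a value $c_{od}^{UB}\in\mathbb{R}\cup\{+\infty\}$, and for each vertex $v$ a list $M_v$ of $o$-$v$ paths. Initially $L$ contains only the empty path at $o$, $c_{od}^{UB}=+\infty$, and all $M_v$ are empty. While $L$ is nonempty, repeat: (1) extract (remove) from $L$ a path $P$, with destination denoted $v$, of minimum key $c(x_P)$ among the paths of $L$ (ties broken arbitrarily); (2) if $v=d$, $\rho(x_P)=0$ and $c(x_P)<c_{od}^{UB}$, then set $c_{od}^{UB}:=c(x_P)$; (3) else, if the dominance test "no path in $M_v$ dominates $P$" holds, then remove from $M_v$ and $L$ all the paths of $M_v$ dominated by $P$, add $P$ to $M_v$, and extend $P$: for each arc $a$ outgoing from $v$, add $P+a$ ($P$ followed by $a$) to $L$. *)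

theory Defs
  imports
    "Graph_Theory.Arc_Walk"
    "HOL-Library.Multiset"
    "HOL-Library.Extended_Real"
begin

text \<open>The monoid need not be commutative, so both translations have to be isotone.\<close>

class lattice_ordered_monoid = monoid_add + lattice +
  assumes lom_add_left_mono: "y \<le> z \<Longrightarrow> x + y \<le> x + z"
    and lom_add_right_mono: "y \<le> z \<Longrightarrow> y + x \<le> z + x"

text \<open>
  A path is its list of arcs (an \<^typ>\<open>'a awalk\<close>) together with its origin, so that
  \<open>awalk u P v\<close> says that \<open>P\<close> is a path from \<open>u\<close> to \<open>v\<close>, with repeated vertices and arcs
  allowed. The empty list stands for the empty path at each vertex.
\<close>

definition path_resource :: "('a \<Rightarrow> 'r::monoid_add) \<Rightarrow> 'a awalk \<Rightarrow> 'r" where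
  "path_resource x P = sum_list (map x P)"

text \<open>Cycles need not be elementary.\<close>

definition is_cycle :: "('v, 'a) pre_digraph \<Rightarrow> 'a awalk \<Rightarrow> bool" where
  "is_cycle G C \<longleftrightarrow> C \<noteq> [] \<and> (\<exists>v. pre_digraph.awalk G v C v)"

definition feasible_path ::
  "('v, 'a) pre_digraph \<Rightarrow> 'v \<Rightarrow> 'v \<Rightarrow> ('a \<Rightarrow> 'r::monoid_add) \<Rightarrow> ('r \<Rightarrow> nat) \<Rightarrow> 'a awalk \<Rightarrow> bool"
where
  "feasible_path G src dst x \<rho> P \<longleftrightarrow>
     pre_digraph.awalk G src P dst \<and> \<rho> (path_resource x P) = 0"

definition optimal_path ::
  "('v, 'a) pre_digraph \<Rightarrow> 'v \<Rightarrow> 'v \<Rightarrow> ('a \<Rightarrow> 'r::monoid_add) \<Rightarrow> ('r \<Rightarrow> real) \<Rightarrow> ('r \<Rightarrow> nat)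
    \<Rightarrow> 'a awalk \<Rightarrow> bool"
where
  "optimal_path G src dst x c \<rho> P \<longleftrightarrow>
     feasible_path G src dst x \<rho> P \<and>
     (\<forall>Q. feasible_path G src dst x \<rho> Q \<longrightarrow> c (path_resource x P) \<le> c (path_resource x Q))"

text \<open>No \<open>src\<close>-\<open>dst\<close> path, feasible or not, has a strictly smaller resource.\<close>

definition non_dominated_path ::
  "('v, 'a) pre_digraph \<Rightarrow> 'v \<Rightarrow> 'v \<Rightarrow> ('a \<Rightarrow> 'r::lattice_ordered_monoid) \<Rightarrow> 'a awalk \<Rightarrow> bool"
where
  "non_dominated_path G src dst x P \<longleftrightarrow>
     \<not> (\<exists>Q. pre_digraph.awalk G src Q dst \<and> path_resource x Q < path_resource x P)"

text \<open>Only used for two paths with the same origin and the same destination.\<close>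

definition dominates_path ::
  "('a \<Rightarrow> 'r::lattice_ordered_monoid) \<Rightarrow> 'a awalk \<Rightarrow> 'a awalk \<Rightarrow> bool"
where
  "dominates_path x P Q \<longleftrightarrow> path_resource x P \<le> path_resource x Q"

text \<open>
  All paths handled by the algorithm have origin \<open>src\<close>. The list \<open>L\<close> of the algorithm is a
  multiset, because the order of its entries is irrelevant.
\<close>

record ('v, 'a) label_state =
  pending :: "'a awalk multiset"
  upper_bound :: ereal
  labels :: "'v \<Rightarrow> 'a awalk set"

definition initial_state :: "('v, 'a) label_state" where
  "initial_state = \<lparr>pending = {#[]#}, upper_bound = \<infinity>, labels = (\<lambda>v. {})\<rparr>"

text \<open>The body of one iteration, for the path \<open>P\<close> extracted from \<open>L\<close>.\<close>

definition process_path ::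
  "('v, 'a) pre_digraph \<Rightarrow> 'v \<Rightarrow> 'v \<Rightarrow> ('a \<Rightarrow> 'r::lattice_ordered_monoid) \<Rightarrow> ('r \<Rightarrow> real)
    \<Rightarrow> ('r \<Rightarrow> nat) \<Rightarrow> 'a awalk \<Rightarrow> ('v, 'a) label_state \<Rightarrow> ('v, 'a) label_state"
where
  "process_path G src dst x c \<rho> P s =
    (let v = pre_digraph.awlast G src P;
         r = path_resource x P;
         L = pending s - {#P#};
         M = labels s v
     in if v = dst \<and> \<rho> r = 0 \<and> ereal (c r) < upper_bound s then
          s\<lparr>pending := L, upper_bound := ereal (c r)\<rparr>
        else if \<not> (\<exists>Q\<in>M. dominates_path x Q P) then
          (let R = {Q \<in> M. dominates_path x P Q}
           in s\<lparr>pending := filter_mset (\<lambda>Q. Q \<notin> R) L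
                  + image_mset (\<lambda>a. P @ [a]) (mset_set (out_arcs G v)),
                labels := (labels s)(v := insert P (M - R))\<rparr>)
        else s\<lparr>pending := L\<rparr>)"

text \<open>
  One iteration. The relation is not deterministic: any path of minimum key may be extracted.
  It has no successor exactly when \<open>L\<close> is empty.
\<close>

definition label_step ::
  "('v, 'a) pre_digraph \<Rightarrow> 'v \<Rightarrow> 'v \<Rightarrow> ('a \<Rightarrow> 'r::lattice_ordered_monoid) \<Rightarrow> ('r \<Rightarrow> real)
    \<Rightarrow> ('r \<Rightarrow> nat) \<Rightarrow> ('v, 'a) label_state \<Rightarrow> ('v, 'a) label_state \<Rightarrow> bool"
where
  "label_step G src dst x c \<rho> s s' \<longleftrightarrow>
     (\<exists>P. P \<in># pending s \<and>
          (\<forall>Q. Q \<in># pending s \<longrightarrow> c (path_resource x P) \<le> c (path_resource x Q)) \<and>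
          s' = process_path G src dst x c \<rho> P s)"

lemma label_step_total:
  "(\<exists>s'. label_step G src dst x c \<rho> s s') \<longleftrightarrow> pending s \<noteq> {#}"
proof
  assume "pending s \<noteq> {#}"
  then have "finite (set_mset (pending s))" "set_mset (pending s) \<noteq> {}"
    by auto
  then obtain P where "is_arg_min (\<lambda>P. c (path_resource x P)) (\<lambda>P. P \<in># pending s) P"
    using ex_is_arg_min_if_finite[of "set_mset (pending s)" "\<lambda>P. c (path_resource x P)"] by auto
  then show "\<exists>s'. label_step G src dst x c \<rho> s s'"
    unfolding label_step_def is_arg_min_linorder by blast
qed (auto simp: label_step_def)

end

theory Submission
  imports Defs
begin

text \<open>
  Cycles have nonnegative resource, so deleting cycles turns any path into an elementary one that
  dominates it; in particular, an extension that closes a cycle is dominated by the label of the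
  vertex it returns to. Hence only elementary paths are extended, and the multiset of remaining
  lengths of the paths in the list decreases. At the end, follow an elementary feasible
  path arc by arc: each proper prefix is dominated by a label of its end vertex, whose
  extension along the next arc has been processed. A non-dominated optimum is
  an optimum of minimal resource among the finitely many elementary paths.
\<close>

locale label_search = fin_digraph G for G :: "('v, 'a) pre_digraph" +
  fixes src dst :: 'v
    and x :: "'a \<Rightarrow> 'r::lattice_ordered_monoid"
    and c :: "'r \<Rightarrow> real"
    and \<rho> :: "'r \<Rightarrow> nat"
  assumes src_in_verts: "src \<in> verts G"
    and mono_c: "mono c"
    and mono_rho: "mono \<rho>"
    and cycle_nonneg: "is_cycle G C \<Longrightarrow> 0 \<le> path_resource x C"
begin

section \<open>Deletion of cycles and elementary paths\<close>

abbreviation res :: "'a awalk \<Rightarrow> 'r" where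
  "res \<equiv> path_resource x"

lemma res_append: "res (P @ Q) = res P + res Q"
  by (simp add: path_resource_def)

text \<open>Translates \<open>0 \<le> res C\<close> by \<open>res A\<close> on the left and then by
  \<open>res B\<close> on the right; the order of the summands is kept, so no commutativity
  enters.\<close>

lemma res_delete_cycle:
  assumes "awalk v C v" "C \<noteq> []"
  shows "res (A @ B) \<le> res (A @ C @ B)"
proof -
  have "0 \<le> res C"
    using assms cycle_nonneg[of C] by (auto simp: is_cycle_def)
  then have "res A + 0 \<le> res A + res C"
    by (rule lom_add_left_mono)
  then have "res A + 0 + res B \<le> res A + res C + res B"
    by (rule lom_add_right_mono)
  then show ?thesis
    by (simp add: res_append add.assoc)
qed

text \<open>A walk with a repeated vertex contains a nonempty closed subwalk. Deleting it shortens
  the walk without increasing the resource, so induction on the length applies.\<close>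

lemma ex_apath_dominating:
  assumes "awalk u P v"
  shows "\<exists>Q. apath u Q v \<and> res Q \<le> res P"
  using assms
proof (induction P rule: length_induct)
  case (1 P)
  show ?case
  proof (cases "distinct (awalk_verts u P)")
    case True
    then show ?thesis using 1 by (auto simp: apath_def)
  next
    case False
    from awalk_not_distinct_decomp[OF "1.prems" False] obtain q r s w
      where P: "P = q @ r @ s" and "0 < length r"
        and w: "awalk u q w" "awalk w r w" "awalk w s v"
      by blast
    then have "length (q @ s) < length P" "awalk u (q @ s) v"
      by (auto simp del: awalk_append_iff intro: awalk_appendI)
    with "1.IH" obtain Q where "apath u Q v" "res Q \<le> res (q @ s)"
      by blast
    moreover have "res (q @ s) \<le> res P"
      unfolding P using w \<open>0 < length r\<close> by (intro res_delete_cycle) auto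
    ultimately show ?thesis by (meson order_trans)
  qed
qed

text \<open>There are finitely many elementary paths, so some resource is minimal among those below
  \<open>res P\<close>. A walk with a strictly smaller resource would be dominated by an elementary
  one in the same finite set, against minimality.\<close>

lemma ex_non_dominated_le:
  assumes "awalk src P dst"
  shows "\<exists>Q. awalk src Q dst \<and> res Q \<le> res P \<and> non_dominated_path G src dst x Q"
proof -
  let ?R = "{r \<in> res ` {Q. apath src Q dst}. r \<le> res P}"
  have "finite ?R"
    using apaths_finite[of src dst] by simp
  moreover have "?R \<noteq> {}"
    using ex_apath_dominating[OF assms] by blast
  ultimately obtain r where r: "r \<in> ?R" and min: "\<And>r'. r' \<in> ?R \<Longrightarrow> r' \<le> r \<Longrightarrow> r = r'"
    using finite_has_minimal[of ?R] by blast
  from r obtain Q where Q: "apath src Q dst" "r = res Q" "res Q \<le> res P"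
    by blast
  have "\<not> res T < res Q" if "awalk src T dst" for T
  proof
    assume "res T < res Q"
    moreover obtain T' where "apath src T' dst" "res T' \<le> res T"
      using ex_apath_dominating[OF \<open>awalk src T dst\<close>] by blast
    ultimately have "res T' < res Q" "res T' \<in> ?R"
      using Q by auto
    with min Q show False by fastforce
  qed
  then show ?thesis
    using Q by (auto simp: non_dominated_path_def apath_def)
qed

section \<open>The loop invariant\<close>

definition dominated :: "('v, 'a) label_state \<Rightarrow> 'a awalk \<Rightarrow> bool" where
  "dominated s R \<longleftrightarrow> (\<exists>Q\<in>labels s (awlast src R). dominates_path x Q R)"

text \<open>The branch-and-bound notion: a path that can no longer improve the incumbent
  value.\<close>

definition fathomed :: "('v, 'a) label_state \<Rightarrow> 'a awalk \<Rightarrow> bool" where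
  "fathomed s R \<longleftrightarrow>
     (awlast src R = dst \<longrightarrow> \<rho> (res R) = 0 \<longrightarrow> upper_bound s \<le> ereal (c (res R)))"

text \<open>A path to \<open>dst\<close> that updates the upper bound is not stored as a label.\<close>

definition processed :: "('v, 'a) label_state \<Rightarrow> 'a awalk \<Rightarrow> bool" where
  "processed s R \<longleftrightarrow> fathomed s R \<and> (awlast src R = dst \<or> dominated s R)"

definition label_extensions :: "('v, 'a) label_state \<Rightarrow> 'a awalk set" where
  "label_extensions s = {Q @ [a] | Q a v. Q \<in> labels s v \<and> a \<in> out_arcs G v}"

text \<open>The clause on prefixes concerns every proper prefix, because a cycle closed by the last
  arc may begin at any earlier vertex. The \<open>butlast\<close> clause leaves only the last vertex
  of a pending path as a possible repetition. The covering clause is restricted to extensions of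
  current labels, so it survives the removal of labels.\<close>

definition invariant :: "('v, 'a) label_state \<Rightarrow> bool" where
  "invariant s \<longleftrightarrow>
     (\<forall>Q. Q \<in># pending s \<longrightarrow> awalk src Q (awlast src Q)) \<and>
     (\<forall>v. \<forall>Q\<in>labels s v. awalk src Q v \<and> fathomed s Q) \<and>
     (\<forall>Q A B. Q \<in># pending s \<longrightarrow> Q = A @ B \<longrightarrow> B \<noteq> [] \<longrightarrow> dominated s A) \<and>
     (\<forall>Q. Q \<in># pending s \<longrightarrow> distinct (awalk_verts src (butlast Q))) \<and>
     (\<forall>R\<in>insert [] (label_extensions s). R \<in># pending s \<or> processed s R) \<and>
     (upper_bound s = \<infinity> \<or>
       (\<exists>P. feasible_path G src dst x \<rho> P \<and> upper_bound s = ereal (c (res P))))"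

lemma
  assumes "invariant s"
  shows pending_awalk: "Q \<in># pending s \<Longrightarrow> awalk src Q (awlast src Q)"
    and label_awalk: "Q \<in> labels s v \<Longrightarrow> awalk src Q v"
    and label_fathomed: "Q \<in> labels s v \<Longrightarrow> fathomed s Q"
    and proper_prefix_dominated: "A @ B \<in># pending s \<Longrightarrow> B \<noteq> [] \<Longrightarrow> dominated s A"
    and butlast_distinct: "Q \<in># pending s \<Longrightarrow> distinct (awalk_verts src (butlast Q))"
    and covered: "R \<in> insert [] (label_extensions s) \<Longrightarrow> R \<in># pending s \<or> processed s R"
    and upper_bound_attained: "upper_bound s \<noteq> \<infinity> \<Longrightarrow>
      \<exists>P. feasible_path G src dst x \<rho> P \<and> upper_bound s = ereal (c (res P))"
  using assms unfolding invariant_def by blast+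

section \<open>The invariant in all reachable states\<close>

lemma invariant_initial: "invariant initial_state"
  using src_in_verts
  by (auto simp: invariant_def initial_state_def label_extensions_def awalk_Nil_iff)

text \<open>Failure of the test for a new bound is exactly \<open>fathomed s P\<close>, so the other
  two branches may assume it.\<close>

lemma label_step_cases:
  assumes "label_step G src dst x c \<rho> s s'"
  obtains
    (update) P where "P \<in># pending s" "awlast src P = dst" "\<rho> (res P) = 0"
      "ereal (c (res P)) < upper_bound s"
      "s' = s\<lparr>pending := pending s - {#P#}, upper_bound := ereal (c (res P))\<rparr>"
  | (extend) P R where "P \<in># pending s" "fathomed s P" "\<not> dominated s P"
      "R = {Q \<in> labels s (awlast src P). dominates_path x P Q}"
      "s' = s\<lparr>pending := filter_mset (\<lambda>Q. Q \<notin> R) (pending s - {#P#})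
                 + image_mset (\<lambda>a. P @ [a]) (mset_set (out_arcs G (awlast src P))),
              labels := (labels s)(awlast src P := insert P (labels s (awlast src P) - R))\<rparr>"
  | (discard) P where "P \<in># pending s" "fathomed s P" "dominated s P"
      "s' = s\<lparr>pending := pending s - {#P#}\<rparr>"
proof -
  from assms obtain P where P: "P \<in># pending s" and s': "s' = process_path G src dst x c \<rho> P s"
    unfolding label_step_def by blast
  consider "awlast src P = dst \<and> \<rho> (res P) = 0 \<and> ereal (c (res P)) < upper_bound s"
    | "\<not> (awlast src P = dst \<and> \<rho> (res P) = 0 \<and> ereal (c (res P)) < upper_bound s)"
      "\<not> dominated s P"
    | "\<not> (awlast src P = dst \<and> \<rho> (res P) = 0 \<and> ereal (c (res P)) < upper_bound s)"
      "dominated s P"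
    by blast
  then show thesis
  proof cases
    case 1
    then show ?thesis
      using update[OF P] s' by (simp add: process_path_def Let_def)
  next
    case 2
    have "s' = s\<lparr>pending := filter_mset
                  (\<lambda>Q. Q \<notin> {Q \<in> labels s (awlast src P). dominates_path x P Q}) (pending s - {#P#})
                 + image_mset (\<lambda>a. P @ [a]) (mset_set (out_arcs G (awlast src P))),
              labels := (labels s)(awlast src P := insert P (labels s (awlast src P) -
                  {Q \<in> labels s (awlast src P). dominates_path x P Q}))\<rparr>"
      unfolding s' process_path_def Let_def using 2 by (subst if_not_P) (auto simp: dominated_def)
    moreover have "fathomed s P"
      using 2 by (auto simp: fathomed_def)
    ultimately show ?thesis
      using extend[OF P] 2 by blast
  next
    case 3
    then have "s' = s\<lparr>pending := pending s - {#P#}\<rparr>"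
      unfolding s' process_path_def Let_def by (auto simp: dominated_def)
    moreover have "fathomed s P"
      using 3 by (auto simp: fathomed_def)
    ultimately show ?thesis
      using discard[OF P] 3 by blast
  qed
qed

text \<open>A label is removed only when the extracted path dominates it and becomes a label of the
  same vertex; transitivity then preserves domination.\<close>

lemma dominated_step:
  assumes "label_step G src dst x c \<rho> s s'" "dominated s A"
  shows "dominated s' A"
  using assms(1)
proof (cases rule: label_step_cases)
  case (extend P R)
  then show ?thesis
    using assms(2) unfolding dominated_def dominates_path_def
    by (cases "awlast src A = awlast src P") (auto intro: order_trans)
qed (use assms(2) in \<open>auto simp: dominated_def\<close>)

text \<open>The upper bound never increases.\<close>

lemma fathomed_step:
  assumes "label_step G src dst x c \<rho> s s'" "fathomed s A"
  shows "fathomed s' A"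
  using assms(1)
proof (cases rule: label_step_cases)
  case (update P)
  then have "upper_bound s' \<le> upper_bound s"
    by simp
  then show ?thesis
    using assms(2) unfolding fathomed_def by (meson order_trans)
qed (use assms(2) in \<open>auto simp: fathomed_def\<close>)

lemma processed_step:
  assumes "label_step G src dst x c \<rho> s s'" "processed s A"
  shows "processed s' A"
  using assms dominated_step fathomed_step unfolding processed_def by blast

text \<open>If the last vertex of \<open>P\<close> repeats an earlier one, the prefix
  \<open>q\<close> up to that visit is dominated by a label of this vertex. Deleting the cycle after
  \<open>q\<close> gives \<open>res q \<le> res P\<close>, so the same label dominates
  \<open>P\<close>.\<close>

lemma not_dominated_distinct:
  assumes "invariant s" "P \<in># pending s" "\<not> dominated s P"
  shows "distinct (awalk_verts src P)"
proof (rule ccontr)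
  assume neg: "\<not> distinct (awalk_verts src P)"
  then have "P \<noteq> []" by auto
  then obtain P' a where P: "P = P' @ [a]"
    by (cases P rule: rev_cases) auto
  have walk: "awalk src (P' @ [a]) (awlast src P)"
    using pending_awalk[OF assms(1,2)] P by simp
  then have walk': "awalk src P' (awlast src P')" "awalk (awlast src P') [a] (awlast src P)"
    by simp_all
  have "awalk_verts src P = awalk_verts src P' @ [awlast src P]"
    using awalk_verts_append[OF walk] by (simp add: P awalk_verts_conv[of src "P' @ [a]"])
  with neg have "\<not> distinct (awalk_verts src P' @ [awlast src P])"
    by metis
  moreover have "distinct (awalk_verts src P')"
    using butlast_distinct[OF assms(1,2)] P by simp
  ultimately have "awlast src P \<in> set (awalk_verts src P')"
    by simp
  from awalk_decomp[OF walk'(1) this] obtain q r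
    where q: "P' = q @ r" "awalk src q (awlast src P)" "awalk (awlast src P) r (awlast src P')"
    by blast
  have "awlast src q = awlast src P"
    using q(2) by (rule awalkE')
  moreover have "dominated s q"
    using proper_prefix_dominated[OF assms(1), of q "r @ [a]"] assms(2) P q(1) by simp
  moreover have "awalk (awlast src P) (r @ [a]) (awlast src P)"
    using q(3) walk'(2) by (rule awalk_appendI)
  then have "res q \<le> res P"
    using res_delete_cycle[of _ "r @ [a]" q "[]"] P q(1) by simp
  ultimately have "dominated s P"
    unfolding dominated_def dominates_path_def by (metis order_trans)
  with assms(3) show False by simp
qed

lemma invariantI:
  assumes "\<And>Q. Q \<in># pending s \<Longrightarrow> awalk src Q (awlast src Q)"
    and "\<And>v Q. Q \<in> labels s v \<Longrightarrow> awalk src Q v"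
    and "\<And>v Q. Q \<in> labels s v \<Longrightarrow> fathomed s Q"
    and "\<And>A B. A @ B \<in># pending s \<Longrightarrow> B \<noteq> [] \<Longrightarrow> dominated s A"
    and "\<And>Q. Q \<in># pending s \<Longrightarrow> distinct (awalk_verts src (butlast Q))"
    and "\<And>R. R \<in> insert [] (label_extensions s) \<Longrightarrow> R \<in># pending s \<or> processed s R"
    and "upper_bound s = \<infinity> \<or>
      (\<exists>P. feasible_path G src dst x \<rho> P \<and> upper_bound s = ereal (c (res P)))"
  shows "invariant s"
  unfolding invariant_def using assms by (intro conjI allI impI ballI) blast+

text \<open>Common to the update and discard cases: the labels stay the same, and the extracted path
  is covered afterwards by being processed.\<close>

lemma invariant_extract:
  assumes step: "label_step G src dst x c \<rho> s s'" and inv: "invariant s"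
    and labels: "labels s' = labels s" and pending: "pending s' = pending s - {#P#}"
    and P: "processed s' P"
    and bound: "upper_bound s' = \<infinity> \<or>
      (\<exists>P. feasible_path G src dst x \<rho> P \<and> upper_bound s' = ereal (c (res P)))"
  shows "invariant s'"
proof -
  have *: "Q \<in># pending s" if "Q \<in># pending s'" for Q
    using that pending by (auto dest: in_diffD)
  show ?thesis
  proof (rule invariantI)
    show "R \<in># pending s' \<or> processed s' R" if "R \<in> insert [] (label_extensions s')" for R
    proof -
      have "R \<in># pending s \<or> processed s R"
        using that covered[OF inv] labels unfolding label_extensions_def by simp
      then show ?thesis
        using processed_step[OF step] P pending by (cases "R = P") (auto simp: in_diff_count)
    qed
    show "dominated s' A" if "A @ B \<in># pending s'" "B \<noteq> []" for A B
      using dominated_step[OF step proper_prefix_dominated[OF inv *]] that by blast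
    show "awalk src Q (awlast src Q)" "distinct (awalk_verts src (butlast Q))"
      if "Q \<in># pending s'" for Q
      using pending_awalk[OF inv *] butlast_distinct[OF inv *] that by blast+
    show "awalk src Q v" "fathomed s' Q" if "Q \<in> labels s' v" for Q v
      using label_awalk[OF inv] fathomed_step[OF step label_fathomed[OF inv]] that labels by auto
  qed (use bound in blast)
qed

lemma invariant_step:
  assumes step: "label_step G src dst x c \<rho> s s'" and inv: "invariant s"
  shows "invariant s'"
  using step
proof (cases rule: label_step_cases)
  case (update P)
  have "feasible_path G src dst x \<rho> P"
    using pending_awalk[OF inv update(1)] update(2,3) by (simp add: feasible_path_def)
  moreover have "processed s' P"
    using update by (auto simp: processed_def fathomed_def)
  ultimately show ?thesis
    using update(5) by (intro invariant_extract[OF step inv, of P]) auto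
next
  case (discard P)
  then have "processed s' P"
    using dominated_step[OF step] fathomed_step[OF step] by (auto simp: processed_def)
  then show ?thesis
    using discard(4) upper_bound_attained[OF inv]
    by (intro invariant_extract[OF step inv, of P]) auto
next
  case (extend P R)
  let ?v = "awlast src P"
  have P_walk: "awalk src P ?v"
    using pending_awalk[OF inv extend(1)] .
  have labels': "labels s' = (labels s)(?v := insert P (labels s ?v - R))"
    using extend(5) by simp
  have pending_ext: "P @ [a] \<in># pending s'" if "a \<in> out_arcs G ?v" for a
    using that extend(5) by (simp add: finite_out_arcs)
  have pendingD: "Q \<in># pending s \<or> (\<exists>a \<in> out_arcs G ?v. Q = P @ [a])" if "Q \<in># pending s'" for Q
    using that extend(5) by (auto simp: finite_out_arcs dest: in_diffD)
  have P_dom: "dominated s' P"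
    using labels' by (auto simp: dominated_def dominates_path_def)
  \<comment> \<open>Paths of \<open>R\<close> are also deleted from the list. They remain covered:
    as former labels they are fathomed, and the new label \<open>P\<close> dominates them.\<close>
  have R_processed: "processed s' Q" if "Q \<in> R" for Q
  proof -
    have "Q \<in> labels s ?v" "dominates_path x P Q"
      using that extend(4) by auto
    moreover from this have "awlast src Q = ?v"
      using label_awalk[OF inv] by auto
    ultimately show ?thesis
      using labels' label_fathomed[OF inv, THEN fathomed_step[OF step]]
      by (auto simp: processed_def dominated_def)
  qed
  have pendingI: "Q \<in># pending s' \<or> processed s' Q" if "Q \<in># pending s" for Q
  proof (cases "Q = P \<or> Q \<in> R")
    case True
    then show ?thesis
      using R_processed P_dom fathomed_step[OF step extend(2)] by (auto simp: processed_def)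
  next
    case False
    then have "Q \<in># pending s - {#P#}" "Q \<notin> R"
      using that by (auto simp: in_diff_count)
    then show ?thesis
      using extend(5) by (simp del: filter_diff_mset)
  qed
  show ?thesis
  proof (rule invariantI)
    show "Q \<in># pending s' \<or> processed s' Q" if Q: "Q \<in> insert [] (label_extensions s')" for Q
    proof -
      \<comment> \<open>Removing \<open>R\<close> from the labels only shrinks the set of
        extensions; new ones come from \<open>P\<close> alone.\<close>
      have "Q \<in> insert [] (label_extensions s) \<or> (\<exists>a\<in>out_arcs G ?v. Q = P @ [a])"
        using Q unfolding label_extensions_def labels' by (auto split: if_splits)
      then show ?thesis
        using covered[OF inv] pendingI pending_ext processed_step[OF step] by blast
    qed
    show "awalk src Q (awlast src Q)" if "Q \<in># pending s'" for Q
      using pendingD[OF that] pending_awalk[OF inv] P_walk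
      by (auto simp: awlast_append awalk_Cons_iff awalk_Nil_iff)
    show "awalk src Q v" "fathomed s' Q" if "Q \<in> labels s' v" for Q v
      using that labels' P_walk label_awalk[OF inv] fathomed_step[OF step] extend(2)
        label_fathomed[OF inv]
      by (auto split: if_splits)
    show "dominated s' A" if AB: "A @ B \<in># pending s'" and B: "B \<noteq> []" for A B
      using pendingD[OF AB]
    proof
      assume "A @ B \<in># pending s"
      then show ?thesis
        using proper_prefix_dominated[OF inv] dominated_step[OF step] B by blast
    next
      assume "\<exists>a\<in>out_arcs G ?v. A @ B = P @ [a]"
      \<comment> \<open>For \<open>B' = []\<close> the prefix is \<open>P\<close> itself, now a
        label; otherwise it is a proper prefix of \<open>P\<close>, which was pending.\<close>
      then obtain B' where "P = A @ B'"
        using B by (cases B rule: rev_cases) auto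
      then show ?thesis
        using P_dom dominated_step[OF step] proper_prefix_dominated[OF inv, of A B'] extend(1)
        by (cases "B' = []") auto
    qed
    \<comment> \<open>For a new path \<open>butlast\<close> returns \<open>P\<close>, which is
      elementary because it passed the dominance test.\<close>
    show "distinct (awalk_verts src (butlast Q))" if "Q \<in># pending s'" for Q
      using pendingD[OF that] butlast_distinct[OF inv] not_dominated_distinct[OF inv extend(1,3)]
      by auto
    show "upper_bound s' = \<infinity> \<or>
        (\<exists>P. feasible_path G src dst x \<rho> P \<and> upper_bound s' = ereal (c (res P)))"
      using upper_bound_attained[OF inv] extend(5) by auto
  qed
qed

lemma invariant_reachable:
  assumes "(label_step G src dst x c \<rho>)\<^sup>*\<^sup>* initial_state s"
  shows "invariant s"
  using assms by induction (use invariant_initial invariant_step in blast)+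

section \<open>Termination\<close>

definition remaining :: "('v, 'a) label_state \<Rightarrow> nat multiset" where
  "remaining s = image_mset (\<lambda>P. card (verts G) - length P) (pending s)"

text \<open>In the multiset order, one entry may be replaced by any finite number of smaller ones.
  An extracted path is replaced at most by its one-arc extensions, and further deletions only
  help.\<close>

lemma remaining_decreases:
  assumes "label_step G src dst x c \<rho> s s'" and inv: "invariant s"
  shows "(remaining s', remaining s) \<in> mult less_than"
proof -
  let ?f = "\<lambda>P :: 'a awalk. card (verts G) - length P"
  have *: "(image_mset ?f (I + K), image_mset ?f (pending s)) \<in> mult less_than"
    if P: "P \<in># pending s" and I: "I \<subseteq># pending s - {#P#}"
      and K: "\<And>Q. Q \<in># K \<Longrightarrow> ?f Q < ?f P" for P I K
  proof -
    \<comment> \<open>\<open>J\<close> collects the paths deleted in addition to \<open>P\<close>,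
      \<open>K\<close> the added ones.\<close>
    obtain J where "pending s - {#P#} = I + J"
      using I unfolding mset_subset_eq_exists_conv by blast
    then have "pending s = I + add_mset P J"
      using insert_DiffM[OF P] by simp
    moreover have "(image_mset ?f I + image_mset ?f K, image_mset ?f I + image_mset ?f (add_mset P J))
        \<in> mult less_than"
      using K by (intro one_step_implies_mult) auto
    ultimately show ?thesis
      by simp
  qed
  show ?thesis
    using assms(1)
  proof (cases rule: label_step_cases)
    case (update P)
    then show ?thesis
      using *[of P "pending s - {#P#}" "{#}"] by (simp add: remaining_def)
  next
    case (discard P)
    then show ?thesis
      using *[of P "pending s - {#P#}" "{#}"] by (simp add: remaining_def)
  next
    case (extend P R)
    have "apath src P (awlast src P)"
      using pending_awalk[OF inv extend(1)] not_dominated_distinct[OF inv extend(1,3)]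
      by (simp add: apath_def)
    \<comment> \<open>The strict bound matters for subtraction on naturals: without it both
      differences could be truncated to 0.\<close>
    then have "length P < card (verts G)"
      by (rule length_apath_less)
    then have less: "card (verts G) - length (P @ [a]) < card (verts G) - length P" for a
      by auto
    define I where "I = filter_mset (\<lambda>Q. Q \<notin> R) (pending s - {#P#})"
    define K where "K = image_mset (\<lambda>a. P @ [a]) (mset_set (out_arcs G (awlast src P)))"
    have "pending s' = I + K"
      using extend(5) by (simp add: I_def K_def del: filter_diff_mset)
    moreover have "I \<subseteq># pending s - {#P#}"
      unfolding I_def by (rule multiset_filter_subset)
    moreover have "card (verts G) - length Q < card (verts G) - length P" if "Q \<in># K" for Q
      using that less unfolding K_def by auto
    ultimately show ?thesis
      using *[OF extend(1)] by (simp add: remaining_def)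
  qed
qed

lemma no_infinite_run:
  "\<not> (\<exists>S. S 0 = initial_state \<and> (\<forall>i::nat. label_step G src dst x c \<rho> (S i) (S (Suc i))))"
proof
  assume "\<exists>S. S 0 = initial_state \<and> (\<forall>i::nat. label_step G src dst x c \<rho> (S i) (S (Suc i)))"
  then obtain S where S0: "S 0 = initial_state"
    and step: "\<And>i::nat. label_step G src dst x c \<rho> (S i) (S (Suc i))"
    by blast
  have "invariant (S i)" for i
    by (induction i) (use S0 step invariant_initial invariant_step in \<open>simp, blast\<close>)
  with step have "(remaining (S (Suc i)), remaining (S i)) \<in> mult less_than" for i
    by (blast intro: remaining_decreases)
  then have "\<exists>f. \<forall>i::nat. (f (Suc i), f i) \<in> mult less_than"
    by (intro exI[of _ "\<lambda>i. remaining (S i)"]) blast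
  moreover have "wf (mult less_than)"
    by (rule wf_mult) simp
  ultimately show False
    unfolding wf_iff_no_infinite_down_chain by blast
qed

section \<open>Correctness of the final bound\<close>

lemma upper_bound_le:
  assumes inv: "invariant s" and empty: "pending s = {#}"
    and feas: "feasible_path G src dst x \<rho> P"
  shows "upper_bound s \<le> ereal (c (res P))"
proof -
  have "awalk src P dst" and "\<rho> (res P) = 0"
    using feas by (auto simp: feasible_path_def)
  \<comment> \<open>An elementary path is chosen so that no proper prefix of it ends at
    \<open>dst\<close>.\<close>
  then obtain Q where Q: "apath src Q dst" and le: "res Q \<le> res P"
    using ex_apath_dominating by blast
  have Q_walk: "awalk src Q dst"
    using Q by (simp add: apath_def)
  \<comment> \<open>The witness is a processed path rather than a label: at \<open>dst\<close> the
    path may have updated the bound without being stored.\<close>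
  have "\<exists>R. processed s R \<and> awlast src R = awlast src A \<and> res R \<le> res A" if "Q = A @ B" for A B
    using that
  proof (induction A arbitrary: B rule: rev_induct)
    case Nil
    then show ?case
      using covered[OF inv, of "[]"] empty by (intro exI[of _ "[]"]) auto
  next
    case (snoc a A)
    then have walk: "awalk src A (awlast src A)" "awalk (awlast src A) (a # B) dst"
      using Q_walk by auto
    then have a: "a \<in> out_arcs G (awlast src A)"
      by (auto simp: awalk_Cons_iff)
    \<comment> \<open>Being processed provides a dominating label only away from \<open>dst\<close>.
      If \<open>A\<close> ended there, \<open>dst\<close> would occur both in \<open>A\<close> and
      after the arc \<open>a\<close>, although \<open>Q\<close> is elementary.\<close>
    have "awlast src A \<noteq> dst"
    proof
      assume *: "awlast src A = dst"
      have "awalk_verts (awlast src A) (a # B) = dst # awalk_verts (head G a) B"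
        using * a by simp
      moreover have "awlast (head G a) B = dst"
        using walk(2) by (auto simp: awalk_Cons_iff)
      then have "dst \<in> set (tl (awalk_verts (awlast src A) (a # B)))"
        by (metis awalk_verts_non_Nil calculation last_in_set list.sel(3))
      moreover have "dst \<in> set (awalk_verts src A)"
        using * by (metis awalk_verts_non_Nil last_in_set)
      ultimately show False
        using apath_decomp_disjoint[OF Q, of A "a # B"] snoc.prems by simp
    qed
    moreover obtain R where R: "processed s R" "awlast src R = awlast src A" "res R \<le> res A"
      using snoc.IH[of "a # B"] snoc.prems by auto
    ultimately obtain T where T: "T \<in> labels s (awlast src A)" "res T \<le> res R"
      by (auto simp: processed_def dominated_def dominates_path_def)
    \<comment> \<open>With an empty list, a covered extension can only be processed.\<close>
    have "processed s (T @ [a])"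
      using covered[OF inv, of "T @ [a]"] T(1) a empty unfolding label_extensions_def by auto
    moreover have "awlast src (T @ [a]) = awlast src (A @ [a])"
      using label_awalk[OF inv T(1)] by (auto simp: awlast_append)
    moreover have "res (T @ [a]) \<le> res (A @ [a])"
      using T(2) R(3) by (simp add: res_append lom_add_right_mono)
    ultimately show ?case by blast
  qed
  from this[of Q "[]"] obtain R where R: "processed s R" "awlast src R = dst" "res R \<le> res Q"
    using Q_walk by auto
  then have "res R \<le> res P"
    using le by simp
  \<comment> \<open>As \<open>\<rho>\<close> takes natural values, isotonicity below a feasible
    resource forces the value 0.\<close>
  then have "\<rho> (res R) = 0" "c (res R) \<le> c (res P)"
    using monoD[OF mono_rho] monoD[OF mono_c] \<open>\<rho> (res P) = 0\<close> by fastforce+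
  then show ?thesis
    using R by (auto simp: processed_def fathomed_def intro: order_trans)
qed

text \<open>The path that set the bound may itself be dominated. A non-dominated path
  \<open>Q\<close> below it is feasible and costs no more, since \<open>\<rho>\<close> and
  \<open>c\<close> are isotone; minimality of the bound makes the costs equal.\<close>

lemma upper_bound_correct:
  assumes inv: "invariant s" and empty: "pending s = {#}"
  shows "if \<bar>upper_bound s\<bar> \<noteq> \<infinity>
         then \<exists>P. optimal_path G src dst x c \<rho> P \<and> non_dominated_path G src dst x P \<and>
                  upper_bound s = ereal (c (res P))
         else \<not> (\<exists>P. feasible_path G src dst x \<rho> P)"
proof (cases "upper_bound s = \<infinity>")
  case True
  then show ?thesis
    using upper_bound_le[OF inv empty] by auto
next
  case False
  \<comment> \<open>A bound other than \<infinity> is the real cost of a feasible path, which also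
    excludes minus infinity.\<close>
  then obtain P where P: "feasible_path G src dst x \<rho> P" "upper_bound s = ereal (c (res P))"
    using upper_bound_attained[OF inv] by blast
  then obtain Q where Q: "awalk src Q dst" "res Q \<le> res P" "non_dominated_path G src dst x Q"
    using ex_non_dominated_le[of P] by (auto simp: feasible_path_def)
  have feas: "feasible_path G src dst x \<rho> Q"
    using Q(1,2) P(1) monoD[OF mono_rho Q(2)] by (simp add: feasible_path_def)
  have "c (res Q) = c (res P)"
    using upper_bound_le[OF inv empty feas] P(2) monoD[OF mono_c Q(2)] by simp
  moreover have "c (res P) \<le> c (res T)" if "feasible_path G src dst x \<rho> T" for T
    using upper_bound_le[OF inv empty that] P(2) by simp
  ultimately have "optimal_path G src dst x c \<rho> Q" "upper_bound s = ereal (c (res Q))"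
    using feas P(2) by (auto simp: optimal_path_def)
  then show ?thesis
    using Q(3) by auto
qed

end

theorem theorem6:
  fixes G :: "('v, 'a) pre_digraph"
    and src dst :: 'v
    and x :: "'a \<Rightarrow> 'r::{lattice_ordered_monoid, conditionally_complete_lattice}"
    and c :: "'r \<Rightarrow> real"
    and \<rho> :: "'r \<Rightarrow> nat"
  assumes "fin_digraph G"
    and "src \<in> verts G" and "dst \<in> verts G"
    and "mono c"
    and "mono \<rho>" and "range \<rho> \<subseteq> {0, 1}"
    and "\<And>C. is_cycle G C \<Longrightarrow> 0 \<le> path_resource x C"
  shows "\<not> (\<exists>S. S 0 = initial_state \<and>
              (\<forall>i::nat. label_step G src dst x c \<rho> (S i) (S (Suc i)))) \<and>
         (\<forall>s. (label_step G src dst x c \<rho>)\<^sup>*\<^sup>* initial_state s \<longrightarrow> pending s = {#} \<longrightarrow>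
           (if \<bar>upper_bound s\<bar> \<noteq> \<infinity>
            then \<exists>P. optimal_path G src dst x c \<rho> P \<and> non_dominated_path G src dst x P \<and>
                     upper_bound s = ereal (c (path_resource x P))
            else \<not> (\<exists>P. feasible_path G src dst x \<rho> P)))"
proof -
  interpret fin_digraph G by fact
  interpret label_search G src dst x c \<rho>
    by unfold_locales (use assms in auto)
  show ?thesis
    using no_infinite_run upper_bound_correct invariant_reachable by blast
qed

end
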